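(* Let $\mathbf R=(R,\leq,\odot,\rightarrow,\leadsto,\bar{}\,,\tilde{}\,,0,1)$ be an unsharp residuated poset and define, for $x,y\in R$, $x+y:=\widetilde{\bar x\odot\bar y}$, defined if and only if $x\leq\bar y$. Then $(R,+,\bar{}\,,\tilde{}\,,0,1)$ is a good pseudoeffect algebra whose induced order coincides with $\leq$.
   Context: For a poset and $A\subseteq R$: $L(A)=\{x\mid x\leq y\ \forall y\in A\}$, $U(A)=\{x\mid y\leq x\ \forall y\in A\}$; $L(a,b)=L(\{a,b\})$, $U(a,b)=U(\{a,b\})$, $LU(A)=L(U(A))$, $UL(a,b)=U(L(\{a,b\}))$. For subsets $A,B$, $A\leq B$ means $x\leq y$ for all $x\in A,y\in B$. Operations are extended elementwise to subsets, e.g. $A\odot y=\{u\odot y\mid u\in A\}$, $y\odot A=\{y\odot u\mid u\in A\}$. We write $\widetilde{t}$ and $\overline{t}$ for the unary operations applied to a term $t$. A partial monoid $(R,\odot,1)$ is a set with a partial binary operation such that $(x\odot y)\odot z$ is defined iff $x\odot(y\odot z)$ is defined and then they are equal, and $x\odot1=1\odot x=x$. An unsharp residuated poset is a tuple $(R,\leq,\odot,\rightarrow,\leadsto,\bar{}\,,\tilde{}\,,0,1)$ with $\rightarrow,\leadsto:R^2\to 2^R$ and unary operations $\bar{}\,,\tilde{}$ such that for all $x,y,z\in R$: (R1) $(R,\leq,0,1)$ is a bounded poset; (R2) $\tilde{\bar x}=\bar{\tilde x}=x$, and $x\leq y$ implies $\bar y\leq\bar x$ and $\tilde y\leq\tilde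 x$; (R3) $(R,\odot,1)$ is a partial monoid where $x\odot y$ is defined iff $\tilde x\leq y$, and $\bar z\leq x\leq y$ implies $x\odot z\leq y\odot z$, and $\tilde z\leq x\leq y$ implies $z\odot x\leq z\odot y$; (R4) $L(U(x,\bar y)\odot y)\leq UL(y,z)$ iff $LU(x,\bar y)\leq U(y\rightarrow z)$; (R5) $L(y\odot U(x,\tilde y))\leq UL(y,z)$ iff $LU(x,\tilde y)\leq U(y\leadsto z)$; (R6) $x\rightarrow0=\{\bar x\}$ and $x\leadsto 0=\{\tilde x\}$; (R7) $\widetilde{\bar x\odot\bar y}=\overline{\tilde x\odot\tilde y}$. A pseudoeffect algebra is a partial algebra $(P,+,\bar{}\,,\tilde{}\,,0,1)$ of type $(2,1,1,0,0)$ where $(P,\bar{}\,,\tilde{}\,,0,1)$ is an algebra and $+$ is a partial binary operation such that for all $x,y,z\in P$: (P1) if $x+y$ is defined then there exist $u,w\in P$ with $u+x=y+w=x+y$; (P2) $(x+y)+z$ is defined iff $x+(y+z)$ is defined, and then they are equal; (P3) $\bar x$ is the unique $u$ with $u+x=1$ and $\tilde x$ is the unique $w$ with $x+w=1$; (P4) if $1+x$ or $x+1$ is defined then $x=0$. Its induced order is $x\leq y$ iff there is $z$ with $x+z=y$. It is good if $\widetilde{\bar x+\bar y}=\overline{\tilde x+\tilde y}$ for all $x,y$ with $\tilde x\leq y$. *)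

theory Defs
  imports Main
begin

text \<open>Carriers are whole types and orders are explicit relations.  A partial binary operation is
  a function into \<^typ>\<open>'a option\<close>, with \<^term>\<open>None\<close> meaning ``undefined''.\<close>

definition lower_bounds :: "('a \<Rightarrow> 'a \<Rightarrow> bool) \<Rightarrow> 'a set \<Rightarrow> 'a set" where
  "lower_bounds le A = {x. \<forall>y\<in>A. le x y}"

definition upper_bounds :: "('a \<Rightarrow> 'a \<Rightarrow> bool) \<Rightarrow> 'a set \<Rightarrow> 'a set" where
  "upper_bounds le A = {x. \<forall>y\<in>A. le y x}"

definition set_le :: "('a \<Rightarrow> 'a \<Rightarrow> bool) \<Rightarrow> 'a set \<Rightarrow> 'a set \<Rightarrow> bool" where
  "set_le le A B \<longleftrightarrow> (\<forall>x\<in>A. \<forall>y\<in>B. le x y)"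

text \<open>Elementwise extension of a partial operation to subsets, collecting the defined values.  In
  the residuation axioms below no product is lost: \<open>le (bar y) u\<close> yields \<open>le (tilde u) y\<close>, so
  \<open>odot u y\<close> is defined, and \<open>le (tilde y) u\<close> makes \<open>odot y u\<close> defined.\<close>

definition set_op_elem :: "('a \<Rightarrow> 'a \<Rightarrow> 'a option) \<Rightarrow> 'a set \<Rightarrow> 'a \<Rightarrow> 'a set" where
  "set_op_elem f A y = {w. \<exists>u\<in>A. f u y = Some w}"

definition elem_op_set :: "('a \<Rightarrow> 'a \<Rightarrow> 'a option) \<Rightarrow> 'a \<Rightarrow> 'a set \<Rightarrow> 'a set" where
  "elem_op_set f y A = {w. \<exists>u\<in>A. f y u = Some w}"

text \<open>Equations between options, here via \<^const>\<open>Option.bind\<close> and later via \<^const>\<open>map_option\<close>,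
  say that one side is defined iff the other is, and then they are equal.\<close>

locale partial_monoid =
  fixes odot :: "'a \<Rightarrow> 'a \<Rightarrow> 'a option" and one :: 'a
  assumes assoc:
      "Option.bind (odot x y) (\<lambda>u. odot u z) = Option.bind (odot y z) (\<lambda>v. odot x v)"
    and right_unit: "odot x one = Some x"
    and left_unit: "odot one x = Some x"

locale bounded_poset =
  fixes le :: "'a \<Rightarrow> 'a \<Rightarrow> bool" and zero one :: 'a
  assumes refl: "reflp le"
    and antisym: "antisymp le"
    and trans: "transp le"
    and zero_least: "le zero x"
    and one_greatest: "le x one"

text \<open>\<open>arrow\<close> and \<open>larrow\<close> are \<open>\<rightarrow>\<close> and \<open>\<leadsto>\<close>.\<close>

locale unsharp_residuated_poset =
  bounded_poset le zero one + partial_monoid odot one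
  for le :: "'a \<Rightarrow> 'a \<Rightarrow> bool"
    and odot :: "'a \<Rightarrow> 'a \<Rightarrow> 'a option"
    and arrow :: "'a \<Rightarrow> 'a \<Rightarrow> 'a set"
    and larrow :: "'a \<Rightarrow> 'a \<Rightarrow> 'a set"
    and bar :: "'a \<Rightarrow> 'a"
    and tilde :: "'a \<Rightarrow> 'a"
    and zero :: 'a
    and one :: 'a +
  assumes tilde_bar: "tilde (bar x) = x"
    and bar_tilde: "bar (tilde x) = x"
    and bar_antitone: "le x y \<Longrightarrow> le (bar y) (bar x)"
    and tilde_antitone: "le x y \<Longrightarrow> le (tilde y) (tilde x)"
    and odot_defined_iff: "odot x y \<noteq> None \<longleftrightarrow> le (tilde x) y"
    and odot_mono_left:
      "\<lbrakk>le (bar z) x; le x y; odot x z = Some u; odot y z = Some v\<rbrakk> \<Longrightarrow> le u v"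
    and odot_mono_right:
      "\<lbrakk>le (tilde z) x; le x y; odot z x = Some u; odot z y = Some v\<rbrakk> \<Longrightarrow> le u v"
    and arrow_residuation:
      "set_le le (lower_bounds le (set_op_elem odot (upper_bounds le {x, bar y}) y))
                 (upper_bounds le (lower_bounds le {y, z}))
       \<longleftrightarrow> set_le le (lower_bounds le (upper_bounds le {x, bar y}))
                    (upper_bounds le (arrow y z))"
    and larrow_residuation:
      "set_le le (lower_bounds le (elem_op_set odot y (upper_bounds le {x, tilde y})))
                 (upper_bounds le (lower_bounds le {y, z}))
       \<longleftrightarrow> set_le le (lower_bounds le (upper_bounds le {x, tilde y}))
                    (upper_bounds le (larrow y z))"
    and arrow_zero: "arrow x zero = {bar x}"
    and larrow_zero: "larrow x zero = {tilde x}"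
    and tilde_odot_bar:
      "map_option tilde (odot (bar x) (bar y)) = map_option bar (odot (tilde x) (tilde y))"

locale pseudoeffect_algebra =
  fixes padd :: "'a \<Rightarrow> 'a \<Rightarrow> 'a option"
    and bar :: "'a \<Rightarrow> 'a"
    and tilde :: "'a \<Rightarrow> 'a"
    and zero :: 'a
    and one :: 'a
  assumes conjugation:
      "padd x y = Some s \<Longrightarrow> \<exists>u w. padd u x = Some s \<and> padd y w = Some s"
    and assoc:
      "Option.bind (padd x y) (\<lambda>u. padd u z) = Option.bind (padd y z) (\<lambda>v. padd x v)"
    and bar_unique: "padd u x = Some one \<longleftrightarrow> u = bar x"
    and tilde_unique: "padd x w = Some one \<longleftrightarrow> w = tilde x"
    and zero_one: "padd one x \<noteq> None \<or> padd x one \<noteq> None \<Longrightarrow> x = zero"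

definition induced_le :: "('a \<Rightarrow> 'a \<Rightarrow> 'a option) \<Rightarrow> 'a \<Rightarrow> 'a \<Rightarrow> bool" where
  "induced_le padd x y \<longleftrightarrow> (\<exists>z. padd x z = Some y)"

text \<open>The equation between partial sums is read in the strong sense: both sums are defined.\<close>

locale good_pseudoeffect_algebra = pseudoeffect_algebra +
  assumes good: "induced_le padd (tilde x) y \<Longrightarrow>
    \<exists>u v. padd (bar x) (bar y) = Some u \<and> padd (tilde x) (tilde y) = Some v
      \<and> tilde u = bar v"

definition residuated_plus ::
  "('a \<Rightarrow> 'a \<Rightarrow> bool) \<Rightarrow> ('a \<Rightarrow> 'a \<Rightarrow> 'a option) \<Rightarrow> ('a \<Rightarrow> 'a) \<Rightarrow> ('a \<Rightarrow> 'a)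
    \<Rightarrow> 'a \<Rightarrow> 'a \<Rightarrow> 'a option" where
  "residuated_plus le odot bar tilde x y =
     (if le x (bar y) then map_option tilde (odot (bar x) (bar y)) else None)"

end

theory Submission imports Defs
begin

text \<open>For \<open>z = 0\<close> the residuation law (R4) says that a defined product \<open>x \<odot> y\<close> is \<open>0\<close>
  only if \<open>x = bar y\<close>, which in terms of \<open>+\<close> is the uniqueness of complements.  Associativity is
  inherited from \<open>\<odot>\<close>.  If \<open>x \<le> y\<close>, then \<open>s = x + tilde y\<close> and \<open>t = bar y + x\<close> are defined, and
  reassociating \<open>bar s + (x + tilde y) = 1\<close> and \<open>(bar y + x) + tilde t = 1\<close> gives \<open>bar s + x = y\<close>
  and \<open>x + tilde t = y\<close>.  Since summands lie below a sum by monotonicity, this yields both the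
  conjugation law and the description of the order.\<close>

context unsharp_residuated_poset
begin

abbreviation plus :: "'a \<Rightarrow> 'a \<Rightarrow> 'a option" where
  "plus \<equiv> residuated_plus le odot bar tilde"

lemma le_refl: "le x x"
  using refl by (rule reflpD)

lemma le_antisym: "le x y \<Longrightarrow> le y x \<Longrightarrow> x = y"
  using antisym by (rule antisympD)

lemma le_trans: "le x y \<Longrightarrow> le y z \<Longrightarrow> le x z"
  using trans by (rule transpD)

text \<open>Lets the definedness of \<open>odot x y\<close> be read as the side condition of
  \<open>odot_mono_left\<close>.\<close>

lemma tilde_le_iff: "le (tilde x) y \<longleftrightarrow> le (bar y) x"
  by (metis tilde_bar bar_tilde bar_antitone tilde_antitone)

lemma bar_one: "bar one = zero"
  by (metis bar_antitone bar_tilde le_antisym one_greatest zero_least)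

lemma bar_zero: "bar zero = one"
  by (metis bar_antitone bar_tilde le_antisym one_greatest zero_least)

lemma odot_eq_zero_iff: "odot x y = Some zero \<longleftrightarrow> x = bar y"
proof -
  have *: "w = zero \<longleftrightarrow> le x (bar y)" if xy: "odot x y = Some w" for w
  proof -
    have yx: "le (bar y) x"
      using xy odot_defined_iff[of x y] by (simp add: tilde_le_iff)
    \<comment> \<open>Since \<open>x\<close> itself bounds \<open>x\<close> and \<open>bar y\<close>
      from above, \<open>w\<close> is the least element of the set of products in the residuation
      law.\<close>
    have "le w v" if "le x u" "odot u y = Some v" for u v
      using odot_mono_left[OF yx that(1) xy that(2)] .
    then have "lower_bounds le (set_op_elem odot (upper_bounds le {x, bar y}) y) = {v. le v w}"
      using xy yx le_trans le_refl
      unfolding lower_bounds_def set_op_elem_def upper_bounds_def by blast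
    moreover have "upper_bounds le (lower_bounds le {y, zero}) = UNIV"
      using zero_least le_trans unfolding lower_bounds_def upper_bounds_def by blast
    moreover have "set_le le {v. le v w} UNIV \<longleftrightarrow> w = zero"
      using zero_least le_refl le_trans le_antisym unfolding set_le_def by blast
    moreover have "set_le le (lower_bounds le (upper_bounds le {x, bar y}))
        (upper_bounds le (arrow y zero)) \<longleftrightarrow> le x (bar y)"
      unfolding arrow_zero set_le_def lower_bounds_def upper_bounds_def
      using le_refl le_trans by blast
    ultimately show ?thesis
      using arrow_residuation[of x y zero] by simp
  qed
  \<comment> \<open>For the converse direction: once this product exists, \<open>*\<close> forces
    its value to be \<open>zero\<close>.\<close>
  have "odot (bar y) y \<noteq> None"
    unfolding odot_defined_iff by (simp add: tilde_bar le_refl)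
  then show ?thesis
    using * le_refl le_antisym odot_defined_iff[of x y]
    by (metis option.distinct(1) option.exhaust tilde_le_iff)
qed

text \<open>By \<open>tilde (bar x) = x\<close>, the guard in \<open>residuated_plus\<close> is
  exactly the definedness of the product.\<close>

lemma plus_eq_tilde: "plus x y = map_option tilde (odot (bar x) (bar y))"
  using odot_defined_iff[of "bar x" "bar y"] by (auto simp: residuated_plus_def tilde_bar)

lemma plus_eq_bar: "plus x y = map_option bar (odot (tilde x) (tilde y))"
  by (simp add: plus_eq_tilde tilde_odot_bar)

lemma plus_defined_iff: "plus x y \<noteq> None \<longleftrightarrow> le x (bar y)"
  using odot_defined_iff[of "bar x" "bar y"] by (simp add: plus_eq_tilde tilde_bar)

text \<open>As \<open>bar\<close> cancels the outer \<open>tilde\<close>, it carries sums to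
  products, so nested sums become nested products.\<close>

lemma plus_assoc:
  "Option.bind (plus x y) (\<lambda>u. plus u z) = Option.bind (plus y z) (\<lambda>v. plus x v)"
proof -
  have "Option.bind (plus x y) (\<lambda>u. plus u z) =
      map_option tilde (Option.bind (odot (bar x) (bar y)) (\<lambda>u. odot u (bar z)))"
    by (cases "odot (bar x) (bar y)") (simp_all add: plus_eq_tilde bar_tilde)
  also have "\<dots> = map_option tilde (Option.bind (odot (bar y) (bar z)) (\<lambda>v. odot (bar x) v))"
    by (simp add: assoc)
  also have "\<dots> = Option.bind (plus y z) (\<lambda>v. plus x v)"
    by (cases "odot (bar y) (bar z)") (simp_all add: plus_eq_tilde bar_tilde)
  finally show ?thesis .
qed

lemma plus_eq_one_iff_bar: "plus u x = Some one \<longleftrightarrow> u = bar x"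
proof -
  have "plus u x = Some one \<longleftrightarrow> odot (bar u) (bar x) = Some zero"
    unfolding plus_eq_tilde by (auto simp: map_option_eq_Some) (metis bar_tilde bar_one tilde_bar)+
  then show ?thesis
    by (metis odot_eq_zero_iff tilde_bar)
qed

lemma plus_eq_one_iff_tilde: "plus x w = Some one \<longleftrightarrow> w = tilde x"
  by (metis plus_eq_one_iff_bar bar_tilde tilde_bar)

lemma le_imp_left_summand:
  assumes "le x y"
  shows "\<exists>u. plus u x = Some y"
proof -
  obtain s where s: "plus x (tilde y) = Some s"
    using plus_defined_iff[of x "tilde y"] assms by (auto simp: bar_tilde)
  \<comment> \<open>Reassociated, this is \<open>bar s + s\<close>. The left summand of
    \<open>tilde y\<close> here must then be \<open>bar (tilde y) = y\<close>.\<close>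
  have "Option.bind (plus (bar s) x) (\<lambda>u. plus u (tilde y)) = Some one"
    by (simp add: plus_assoc s plus_eq_one_iff_bar)
  then show ?thesis
    by (auto simp: bind_eq_Some_conv plus_eq_one_iff_bar bar_tilde)
qed

lemma le_imp_right_summand:
  assumes "le x y"
  shows "\<exists>w. plus x w = Some y"
proof -
  obtain t where t: "plus (bar y) x = Some t"
    using plus_defined_iff[of "bar y" x] bar_antitone[OF assms] by auto
  have "Option.bind (plus x (tilde t)) (\<lambda>v. plus (bar y) v) = Some one"
    by (simp add: plus_assoc[symmetric] t plus_eq_one_iff_tilde)
  then show ?thesis
    by (auto simp: bind_eq_Some_conv plus_eq_one_iff_tilde tilde_bar)
qed

lemma summands_le:
  assumes "plus x y = Some s"
  shows "le x s" and "le y s"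
proof -
  obtain p where p: "odot (bar x) (bar y) = Some p" and s: "s = tilde p"
    using assms by (auto simp: plus_eq_tilde)
  have xy: "le x (bar y)"
    using assms plus_defined_iff[of x y] by simp
  \<comment> \<open>Enlarging the factor \<open>bar y\<close> to \<open>one\<close> turns
    \<open>p\<close> into \<open>bar x\<close>; \<open>tilde\<close> then reverses the
    inequality.\<close>
  have "le p (bar x)"
    using odot_mono_right[of "bar x", OF _ one_greatest p right_unit] xy by (simp add: tilde_bar)
  then show "le x s"
    using tilde_antitone s by (metis tilde_bar)
  have "le p (bar y)"
    using odot_mono_left[of "bar y", OF _ one_greatest p left_unit] xy bar_antitone by simp
  then show "le y s"
    using tilde_antitone s by (metis tilde_bar)
qed

lemma induced_le_plus_iff: "induced_le plus x y \<longleftrightarrow> le x y"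
  unfolding induced_le_def using summands_le(1) le_imp_right_summand by blast

lemma good_pseudoeffect_algebra_plus: "good_pseudoeffect_algebra plus bar tilde zero one"
proof
  show "\<exists>u w. plus u x = Some s \<and> plus y w = Some s" if "plus x y = Some s" for x y s
    using that summands_le le_imp_left_summand le_imp_right_summand by blast
  show "x = zero" if "plus one x \<noteq> None \<or> plus x one \<noteq> None" for x
    using that unfolding plus_defined_iff bar_one
    by (metis bar_zero le_antisym one_greatest tilde_bar zero_least)
  show "\<exists>u v. plus (bar x) (bar y) = Some u \<and> plus (tilde x) (tilde y) = Some v
      \<and> tilde u = bar v" if xy: "induced_le plus (tilde x) y" for x y
  proof -
    obtain p where "odot x y = Some p"
      using xy odot_defined_iff[of x y] by (auto simp: induced_le_plus_iff)
    \<comment> \<open>Writing one sum with outer \<open>bar\<close> and the other with outer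
      \<open>tilde\<close> reduces both to the same product \<open>p\<close>.\<close>
    then have "plus (bar x) (bar y) = Some (bar p)" "plus (tilde x) (tilde y) = Some (tilde p)"
      by (simp_all add: plus_eq_bar[of "bar x"] plus_eq_tilde[of "tilde x"] tilde_bar bar_tilde)
    then show ?thesis
      by (simp add: tilde_bar bar_tilde)
  qed
qed (rule plus_assoc plus_eq_one_iff_bar plus_eq_one_iff_tilde)+

end

theorem theorem5:
  fixes le :: "'a \<Rightarrow> 'a \<Rightarrow> bool"
    and odot :: "'a \<Rightarrow> 'a \<Rightarrow> 'a option"
    and arrow larrow :: "'a \<Rightarrow> 'a \<Rightarrow> 'a set"
    and bar tilde :: "'a \<Rightarrow> 'a"
    and zero one :: 'a
  assumes "unsharp_residuated_poset le odot arrow larrow bar tilde zero one"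
  shows "good_pseudoeffect_algebra (residuated_plus le odot bar tilde) bar tilde zero one
    \<and> (\<forall>x y. induced_le (residuated_plus le odot bar tilde) x y \<longleftrightarrow> le x y)"
proof -
  interpret unsharp_residuated_poset le odot arrow larrow bar tilde zero one
    by (rule assms)
  show ?thesis
    using good_pseudoeffect_algebra_plus induced_le_plus_iff by blast
qed

end
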